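(* Let $\alpha,\beta\in(0,1]$ and, for $t,s\in[0,1]$, let $$G(t,s)=\begin{cases}u(t,s) & : t\le s,\\ u(s,t) & : s\le t,\end{cases}$$ where $$u(t,s)=\frac{t^{\alpha}}{\alpha\beta(\alpha+\beta)(2\alpha+\beta)}\left[2\alpha s^{\alpha}(1-s^{\beta})-\beta(1-s^{\alpha})\left(t^{\alpha+\beta}+s^{\alpha+\beta}\right)\right].$$ Then $G(t,s)>0$ for all $t,s\in(0,1)$.
   Context: $G$ is the Green's function of the conformable fractional Lidstone problem $D^{\beta}D^{\alpha}D^{\beta}D^{\alpha}x=0$, $x(0)=0=D^{\beta}D^{\alpha}x(0)$, $x(1)=0=D^{\beta}D^{\alpha}x(1)$, but the claim only uses the explicit formula for $G$. *)

theory Defs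
  imports Complex_Main
begin

definition green_u :: "real \<Rightarrow> real \<Rightarrow> real \<Rightarrow> real \<Rightarrow> real" where
  "green_u \<alpha> \<beta> t s =
     t powr \<alpha> / (\<alpha> * \<beta> * (\<alpha> + \<beta>) * (2 * \<alpha> + \<beta>)) *
     (2 * \<alpha> * s powr \<alpha> * (1 - s powr \<beta>)
      - \<beta> * (1 - s powr \<alpha>) * (t powr (\<alpha> + \<beta>) + s powr (\<alpha> + \<beta>)))"

(* Intended for t, s in [0,1]. The two branches of the original definition agree when t = s.
   For positive exponents 0 powr a = 0, so powr is the usual power on all of [0,1]. *)
definition green_G :: "real \<Rightarrow> real \<Rightarrow> real \<Rightarrow> real \<Rightarrow> real" where
  "green_G \<alpha> \<beta> t s = (if t \<le> s then green_u \<alpha> \<beta> t s else green_u \<alpha> \<beta> s t)"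

end

theory Submission
  imports Defs
begin

text \<open>
  By symmetry let \<open>t \<le> s\<close>. The bracket in \<open>u(t,s)\<close> decreases in \<open>t\<close>, so it is at least its value on
  the diagonal \<open>t = s\<close>, which factors as
  \<open>2 s\<^sup>\<alpha> (\<alpha> (1 - s\<^sup>\<beta>) - \<beta> s\<^sup>\<beta> (1 - s\<^sup>\<alpha>))\<close>. Dividing the second factor by \<open>s\<^sup>\<beta>\<close> leaves the inequality
  \<open>\<beta> (1 - s\<^sup>\<alpha>) < \<alpha> (s\<^sup>-\<^sup>\<beta> - 1)\<close>, whose two sides are separated by \<open>- \<alpha> \<beta> ln s\<close>: both
  estimates are instances of \<open>exp y \<ge> 1 + y\<close>.
\<close>

text \<open>With \<open>L = - ln s > 0\<close>, the number \<open>a b L\<close> separates \<open>b (1 - exp (- a L))\<close> from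
  \<open>a (exp (b L) - 1)\<close>; multiplying by \<open>exp (- b L)\<close> gives the claim.\<close>
lemma powr_weighted_diff_less:
  fixes a b s :: real
  assumes "a > 0" "b > 0" "0 < s" "s < 1"
  shows "b * s powr b * (1 - s powr a) < a * (1 - s powr b)"
proof -
  define L where "L = - ln s"
  have "L > 0" using assms by (simp add: L_def)
  have sa: "s powr a = exp (- (a * L))" and sb: "s powr b = exp (- (b * L))"
    using assms by (simp_all add: L_def powr_def)
  have "1 - exp (- (a * L)) < a * L"
    using exp_minus_greater[of "a * L"] assms \<open>L > 0\<close> by simp
  then have "b * (1 - exp (- (a * L))) < b * (a * L)"
    using assms by (simp only: mult_strict_left_mono)
  also have "\<dots> = a * (b * L)" by simp
  also have "\<dots> \<le> a * (exp (b * L) - 1)"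
  proof (rule mult_left_mono)
    show "b * L \<le> exp (b * L) - 1"
      using exp_ge_add_one_self[of "b * L"] by linarith
  qed (use assms in simp)
  finally have "exp (- (b * L)) * (b * (1 - exp (- (a * L))))
      < exp (- (b * L)) * (a * (exp (b * L) - 1))"
    by (intro mult_strict_left_mono) auto
  also have "\<dots> = a * (1 - exp (- (b * L)))"
    by (simp add: algebra_simps exp_minus)
  finally show ?thesis
    by (simp add: sa sb mult_ac)
qed

lemma green_u_pos:
  assumes "\<alpha> > 0" "\<beta> > 0" "0 < t" "t \<le> s" "s < 1"
  shows "green_u \<alpha> \<beta> t s > 0"
proof -
  have "s > 0" using assms by simp
  have "t powr (\<alpha> + \<beta>) \<le> s powr (\<alpha> + \<beta>)"
    using assms by (intro powr_mono2) auto
  moreover have "s powr \<alpha> < 1"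
    using powr_less_mono2[of \<alpha> s 1] assms by simp
  ultimately have "\<beta> * (1 - s powr \<alpha>) * (t powr (\<alpha> + \<beta>) + s powr (\<alpha> + \<beta>))
      \<le> \<beta> * (1 - s powr \<alpha>) * (2 * s powr (\<alpha> + \<beta>))"
    using assms by (intro mult_left_mono) auto
  also have "\<dots> = 2 * s powr \<alpha> * (\<beta> * s powr \<beta> * (1 - s powr \<alpha>))"
    by (simp add: powr_add mult_ac)
  also have "\<dots> < 2 * s powr \<alpha> * (\<alpha> * (1 - s powr \<beta>))"
    using powr_weighted_diff_less[of \<alpha> \<beta> s] assms by (intro mult_strict_left_mono) auto
  finally have "2 * \<alpha> * s powr \<alpha> * (1 - s powr \<beta>)
      - \<beta> * (1 - s powr \<alpha>) * (t powr (\<alpha> + \<beta>) + s powr (\<alpha> + \<beta>)) > 0"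
    by (simp add: mult_ac)
  moreover have "t powr \<alpha> / (\<alpha> * \<beta> * (\<alpha> + \<beta>) * (2 * \<alpha> + \<beta>)) > 0"
    using assms by (intro divide_pos_pos mult_pos_pos) auto
  ultimately show ?thesis
    unfolding green_u_def by (intro mult_pos_pos)
qed

theorem theorem4p4:
  fixes \<alpha> \<beta> :: real
  assumes "\<alpha> \<in> {0<..1}" and "\<beta> \<in> {0<..1}"
  shows "\<forall>t\<in>{0<..<1}. \<forall>s\<in>{0<..<1}. green_G \<alpha> \<beta> t s > 0"
  using assms by (auto simp: green_G_def intro!: green_u_pos)

end
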